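(* Let $x$ be a real number with $|x|\le 1$, and for integers $n\ge 0$, $q\ge 1$ let $I_q^{(n)}(x)=\int_0^x t^n(\arcsin t)^q\,dt$. For all integers $n\geq 0$ and $p\geq 0$, $$\sum_{k=0}^{\infty}\frac{\binom{2k}{k}G_p(k)}{4^k} \cdot\frac{x^{2k+n+2}}{2k+n+2} = \frac{(\arcsin{x})^{2p+1}}{(2p+1)!}x^{n+1} -\frac{n+1}{(2p+1)!}I_{2p+1}^{(n)}(x),$$ and for all integers $n\ge 0$ and $p\geq 1$, $$\sum_{k=1}^{\infty}\frac{4^kH_p(k)}{\binom{2k}{k}2k} \cdot\frac{x^{2k+n+1}}{2k+n+1} = \frac{(\arcsin{x})^{2p}}{(2p)!}x^{n+1} -\frac{n+1}{(2p)!}I_{2p}^{(n)}(x).$$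
   Context: $G_0(k)=1$ and for $p\ge 1$, $G_p(k)=\sum_{n_1=0}^{k-1}\frac{1}{(2n_1+1)^2}\sum_{n_2=0}^{n_1-1}\frac{1}{(2n_2+1)^2}\cdots\sum_{n_p=0}^{n_{p-1}-1}\frac{1}{(2n_p+1)^2}$. $H_1(k)=1$ and for $p\ge 1$, $H_{p+1}(k)=\sum_{n_1=1}^{k-1}\frac{1}{(2n_1)^2}\sum_{n_2=1}^{n_1-1}\frac{1}{(2n_2)^2}\cdots\sum_{n_p=1}^{n_{p-1}-1}\frac{1}{(2n_p)^2}$. Empty sums are $0$. *)

theory Defs
  imports "HOL-Analysis.Analysis"
begin

text \<open>
  The nested sums are defined by splitting off the outermost summation, over \<open>n\<^sub>1\<close>;
  the remaining sums form the function of one lower index, evaluated at \<open>n\<^sub>1\<close>.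
\<close>

primrec G :: "nat \<Rightarrow> nat \<Rightarrow> real" where
  "G 0 k = 1"
| "G (Suc p) k = (\<Sum>m = 0..<k. 1 / (2 * real m + 1)\<^sup>2 * G p m)"

text \<open>\<open>H p\<close> is meaningful for \<open>p \<ge> 1\<close> only; \<open>H 0\<close> is left unspecified.\<close>

fun H :: "nat \<Rightarrow> nat \<Rightarrow> real" where
  "H (Suc 0) k = 1"
| "H (Suc (Suc p)) k = (\<Sum>m = 1..<k. 1 / (2 * real m)\<^sup>2 * H (Suc p) m)"

text \<open>The interval integral is oriented, so this also has the intended meaning for \<open>x < 0\<close>.\<close>

definition I :: "nat \<Rightarrow> nat \<Rightarrow> real \<Rightarrow> real" where
  "I n q x = (LBINT t=0..ereal x. t ^ n * arcsin t ^ q)"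

end

theory Submission
  imports Defs
begin

text \<open>
  Write \<open>A\<^sub>q = arcsin\<^sup>q / q!\<close> and \<open>y\<^sub>q = A\<^sub>q / sqrt (1 - x\<^sup>2)\<close>, the derivative of \<open>A\<^bsub>q+1\<^esub>\<close>.
  With \<open>A\<^bsub>-1\<^esub> = 0\<close>, \<open>(1 - x\<^sup>2) y\<^sub>q' - x y\<^sub>q = A\<^bsub>q-1\<^esub>\<close>, and for \<open>q \<ge> 2\<close> \<open>A\<^bsub>q-1\<^esub>\<close> is an antiderivative of
  \<open>y\<^bsub>q-2\<^esub>\<close>; comparing coefficients gives a recurrence for the Taylor coefficients of \<open>y\<^sub>q\<close>,
  which the numbers built from \<open>G\<close> and \<open>H\<close> satisfy. Integrating \<open>x\<^bsup>n+1\<^esup> y\<^sub>q\<close> by parts proves the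
  identities for \<open>\<bar>x\<bar> < 1\<close>. All coefficients are nonnegative and the right-hand sides are continuous
  on \<open>[-1, 1]\<close>, so the series converge uniformly there and the identities extend to \<open>x = \<plusminus>1\<close>.
\<close>

section \<open>Power series\<close>

text \<open>Termwise division by \<open>i + 1\<close> keeps convergence on the open interval, and
  termwise differentiation recovers \<open>f\<close>. The integrated series and \<open>F\<close>
  thus differ by a constant, which is 0 since both vanish at 0.\<close>

lemma power_series_sums_antiderivative:
  fixes a :: "nat \<Rightarrow> real"
  assumes a: "\<And>x. \<bar>x\<bar> < 1 \<Longrightarrow> (\<lambda>i. a i * x ^ i) sums f x"
    and F: "\<And>x. \<bar>x\<bar> < 1 \<Longrightarrow> (F has_field_derivative f x) (at x)"
    and F0: "F 0 = 0" and x: "\<bar>x\<bar> < 1"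
  shows "(\<lambda>i. a i / real (Suc i) * x ^ Suc i) sums F x"
proof -
  define b where "b = (\<lambda>i. if i = 0 then 0 else a (i - 1) / real i)"
  have summ: "summable (\<lambda>i. b i * z ^ i)" if z: "\<bar>z\<bar> < 1" for z
  proof -
    \<comment> \<open>Convergence at a radius strictly between \<open>\<bar>z\<bar>\<close> and 1
      upgrades to absolute convergence at \<open>z\<close>, as the comparison below
      requires.\<close>
    obtain r where r: "\<bar>z\<bar> < r" "r < 1" using z dense by blast
    have "summable (\<lambda>i. a i * r ^ i)" using a[of r] r by (auto simp: sums_iff)
    then have "summable (\<lambda>i. norm (a i * z ^ i))"
      by (rule powser_insidea) (use r in auto)
    then have "summable (\<lambda>i. b (Suc i) * z ^ Suc i)"
    proof (rule summable_comparison_test'[where N = 0])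
      fix i :: nat
      have "\<bar>a i\<bar> / real (Suc i) * (\<bar>z\<bar> * \<bar>z\<bar> ^ i) \<le> \<bar>a i\<bar> * (1 * \<bar>z\<bar> ^ i)"
        using z by (intro mult_mono) (auto simp: field_simps)
      then show "norm (b (Suc i) * z ^ Suc i) \<le> norm (a i * z ^ i)"
        by (simp add: b_def abs_mult power_abs)
    qed
    then show ?thesis by (subst (asm) summable_Suc_iff)
  qed
  define y where "y = (\<lambda>z. \<Sum>i. b i * z ^ i)"
  have diffs: "diffs b = a" by (auto simp: diffs_def b_def)
  have y': "(y has_field_derivative f z) (at z)" if z: "\<bar>z\<bar> < 1" for z
  proof -
    have "(y has_field_derivative (\<Sum>i. diffs b i * z ^ i)) (at z)"
      unfolding y_def by (rule termdiffs_strong'[where K = 1]) (use summ z in auto)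
    then show ?thesis using a[OF z] by (simp add: diffs sums_iff)
  qed
  have "((\<lambda>z. y z - F z) has_field_derivative 0) (at z)" if "z \<in> {-1<..<1}" for z
    using DERIV_diff[OF y' F, of z] that by auto
  then have "y x - F x = y 0 - F 0"
    using x by (intro DERIV_isconst3[of "-1" 1 x 0]) auto
  moreover have "y 0 = 0" by (simp add: y_def b_def)
  ultimately have "(\<lambda>i. b i * x ^ i) sums F x"
    using summ[OF x] F0 by (simp add: y_def sums_iff)
  then have "(\<lambda>i. b (Suc i) * x ^ Suc i) sums F x"
    by (subst sums_Suc_iff) (simp add: b_def)
  then show ?thesis by (simp add: b_def)
qed

text \<open>Nonnegativity replaces Abel's theorem: partial sums at \<open>z < 1\<close> are at most
  \<open>F z\<close>, so letting \<open>z\<close> tend to 1 bounds the partial sums of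
  \<open>a\<close> by \<open>F 1\<close>. Hence \<open>a\<close> is summable and the Weierstrass
  test makes the sum continuous up to the endpoints.\<close>

lemma power_series_sums_closed_interval:
  fixes a :: "nat \<Rightarrow> real"
  assumes nonneg: "\<And>i. 0 \<le> a i"
    and sums: "\<And>x. \<bar>x\<bar> < 1 \<Longrightarrow> (\<lambda>i. a i * x ^ i) sums F x"
    and cont: "continuous_on {-1..1} F" and x: "\<bar>x\<bar> \<le> 1"
  shows "(\<lambda>i. a i * x ^ i) sums F x"
proof -
  have clos: "closure {-1<..<1::real} = {-1..1}" by simp
  have partial: "(\<Sum>i<m. a i) \<le> F 1" for m
  proof (rule tendsto_le[where F = "at_left (1::real)"])
    show "((\<lambda>z. \<Sum>i<m. a i * z ^ i) \<longlongrightarrow> (\<Sum>i<m. a i)) (at_left 1)"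
      by (auto intro!: tendsto_eq_intros)
    have "(F \<longlongrightarrow> F 1) (at 1 within {-1..1})"
      using cont by (auto simp: continuous_on_def)
    then show "(F \<longlongrightarrow> F 1) (at_left 1)"
      by (simp add: at_within_Icc_at_left)
    have "\<forall>\<^sub>F z in at_left 1. z \<in> {0<..<1::real}"
      by (rule eventually_at_leftI[of 0]) auto
    then show "\<forall>\<^sub>F z in at_left 1. (\<Sum>i<m. a i * z ^ i) \<le> F z"
    proof eventually_elim
      case (elim z)
      then show ?case
        using sums[of z] sum_le_suminf[of "\<lambda>i. a i * z ^ i" "{..<m}"] nonneg
        by (auto simp: sums_iff)
    qed
  qed simp
  have "summable a"
    by (rule summableI_nonneg_bounded[OF nonneg partial])
  then have "uniform_limit {-1..1} (\<lambda>m z. \<Sum>i<m. a i * z ^ i) (\<lambda>z. \<Sum>i. a i * z ^ i) sequentially"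
    using nonneg
    by (intro Weierstrass_m_test) (auto simp: abs_mult power_abs intro!: mult_left_le power_le_one)
  then have cont': "continuous_on {-1..1} (\<lambda>z. \<Sum>i. a i * z ^ i)"
    by (rule uniform_limit_theorem[rotated]) (auto intro!: always_eventually continuous_intros)
  have "(\<Sum>i. a i * x ^ i) - F x = 0"
    by (rule continuous_constant_on_closure[where S = "{-1<..<1}"])
       (use cont cont' sums x in \<open>auto simp: clos sums_iff intro!: continuous_intros\<close>)
  moreover have "summable (\<lambda>i. a i * x ^ i)"
    by (rule summable_comparison_test'[OF \<open>summable a\<close>, where N = 0])
       (use x nonneg in \<open>auto simp: abs_mult power_abs intro!: mult_left_le power_le_one\<close>)
  ultimately show ?thesis by (simp add: sums_iff)
qed

section \<open>The Taylor coefficients\<close>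

text \<open>Intended as the Taylor coefficients of \<open>y\<^sub>q\<close>. The recurrence compares
  coefficients of \<open>x ^ (m + 1)\<close> in the differential equation; for \<open>q < 2\<close>
  its right-hand side is constant and contributes nothing. The starting values are
  \<open>y\<^sub>q\<close> and its derivative at 0.\<close>

fun coef :: "nat \<Rightarrow> nat \<Rightarrow> real" where
  "coef q 0 = (if q = 0 then 1 else 0)"
| "coef q (Suc 0) = (if q = 1 then 1 else 0)"
| "coef q (Suc (Suc m)) =
     (real (m + 1) * coef q m + (if q < 2 then 0 else coef (q - 2) m / real (m + 1))) / real (m + 2)"

lemma coef_nonneg: "0 \<le> coef q m"
  by (induction q m rule: coef.induct) auto

text \<open>This crude bound gives convergence for \<open>\<bar>x\<bar> < 1\<close> by comparison
  with the geometric series.\<close>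

lemma coef_le_1: "coef q m \<le> 1"
proof (induction q m rule: coef.induct)
  case (3 q m)
  have "real (m + 1) * coef q m \<le> real (m + 1)"
    using 3(1) by (simp add: mult_left_le)
  moreover have "(if q < 2 then 0 else coef (q - 2) m / real (m + 1)) \<le> 1"
    using 3(2) by (auto simp: divide_le_eq)
  ultimately have "real (m + 1) * coef q m +
      (if q < 2 then 0 else coef (q - 2) m / real (m + 1)) \<le> real (m + 2)"
    by linarith
  then show ?case by (simp only: coef.simps divide_le_eq_1) simp
qed auto

text \<open>The recurrence shifts each index by 0 or 2, so it preserves the parity of
  \<open>q + m\<close>, and the starting values vanish when that is odd.\<close>

lemma coef_eq_0: "odd (q + m) \<Longrightarrow> coef q m = 0"
  by (induction q m rule: coef.induct) (auto elim: oddE)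

section \<open>Closed forms of the coefficients\<close>

lemma real_central_binomial_Suc:
  "real (Suc k) * real (2 * Suc k choose Suc k) = 2 * real (2 * k + 1) * real (2 * k choose k)"
proof -
  have "Suc k * (2 * Suc k choose Suc k) = 2 * Suc k * (Suc (2 * k) choose k)"
    using Suc_times_binomial[of k "Suc (2 * k)"] by simp
  then have 1: "(2 * Suc k choose Suc k) = 2 * (Suc (2 * k) choose k)"
    by (metis mult.assoc mult.commute mult_cancel1 nat.distinct(1))
  have 2: "Suc k * (Suc (2 * k) choose k) = (2 * k + 1) * (2 * k choose k)"
    using binomial_absorb_comp[of "Suc (2 * k)" k] by (simp add: mult_2)
  show ?thesis using 1 2
    by (metis (no_types, opaque_lifting) mult.left_commute mult.assoc of_nat_mult of_nat_numeral)
qed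

text \<open>The ratio of consecutive central binomial coefficients absorbs the factor
  \<open>(2k + 1) / (2k + 2)\<close> of the recurrence; its second term becomes the new summand
  \<open>m = k\<close> of the outer sum in \<open>G\<close>. That term has lower \<open>p\<close>,
  so \<open>p\<close> stays arbitrary in the induction.\<close>

lemma coef_even:
  "coef (2 * p) (2 * k) = real (2 * k choose k) * G p k / 4 ^ k"
proof (induction k arbitrary: p)
  case 0
  then show ?case by (cases p) auto
next
  case (Suc k)
  define C t w where "C = real (2 * k choose k)" and "t = (4::real) ^ k" and "w = real (2 * k + 1)"
  have pos: "t > 0" "w > 0" by (simp_all add: t_def w_def)
  have IH: "coef (2 * p) (2 * k) = C * G p k / t" for p
    using Suc by (simp only: C_def t_def)
  \<comment> \<open>Here \<open>(w + 1) / 2\<close> is \<open>real (Suc k)\<close>, so that only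
    \<open>w\<close>, \<open>C\<close> and \<open>t\<close> occur in the rational identities
    below.\<close>
  have C': "real (2 * Suc k choose Suc k) = 2 * w * C / ((w + 1) / 2)"
    using real_central_binomial_Suc[of k] by (simp add: C_def w_def field_simps)
  show ?case
  proof (cases p)
    case 0
    have "coef (2 * 0) (2 * Suc k) = w * coef (2 * 0) (2 * k) / (w + 1)"
      by (simp add: w_def)
    also have "\<dots> = 2 * w * C / ((w + 1) / 2) / (4 * t)"
      using pos by (simp only: IH) (simp add: divide_simps)
    finally show ?thesis using 0 by (simp only: C' G.simps t_def power_Suc mult_1_right)
  next
    case (Suc p')
    have "coef (2 * Suc p') (2 * Suc k) =
        (w * coef (2 * Suc p') (2 * k) + coef (2 * p') (2 * k) / w) / (w + 1)"
      by (simp add: w_def)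
    also have "\<dots> = 2 * w * C / ((w + 1) / 2) * (G (Suc p') k + G p' k / w\<^sup>2) / (4 * t)"
      using pos by (simp only: IH) (simp del: G.simps add: divide_simps power2_eq_square, algebra)
    also have "G (Suc p') k + G p' k / w\<^sup>2 = G (Suc p') (Suc k)"
      by (simp add: w_def algebra_simps)
    finally show ?thesis using Suc by (simp only: C' t_def power_Suc)
  qed
qed

text \<open>The induction is as in the even case, with new summand \<open>m = Suc k\<close>. Degree
  \<open>2 * k + 1\<close> pairs with \<open>Suc k\<close> because the series with \<open>H\<close>
  starts at 1.\<close>

lemma coef_odd:
  "coef (2 * p + 1) (2 * k + 1) =
     4 ^ Suc k * H (Suc p) (Suc k) / (real (2 * Suc k choose Suc k) * real (2 * Suc k))"
proof (induction k arbitrary: p)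
  case 0
  then show ?case by (cases p) auto
next
  case (Suc k)
  define C t w where "C = real (2 * Suc k choose Suc k)" and "t = (4::real) ^ Suc k"
    and "w = real (2 * Suc k)"
  have pos: "t > 0" "w > 0" by (simp_all add: t_def w_def)
  have C: "C > 0" by (simp add: C_def del: binomial_Suc_Suc mult_Suc_right)
  have IH: "coef (2 * p + 1) (2 * k + 1) = t * H (Suc p) (Suc k) / (C * w)" for p
    using Suc by (simp only: C_def t_def w_def)
  have C': "real (2 * Suc (Suc k) choose Suc (Suc k)) = 2 * (w + 1) * C / ((w + 2) / 2)"
    using real_central_binomial_Suc[of "Suc k"] by (simp add: C_def w_def field_simps)
  have w': "real (2 * Suc (Suc k)) = w + 2" by (simp add: w_def)
  show ?case
  proof (cases p)
    case 0
    have "coef (2 * 0 + 1) (2 * Suc k + 1) = w * coef (2 * 0 + 1) (2 * k + 1) / (w + 1)"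
      by (simp add: w_def)
    also have "\<dots> = 4 * t / (2 * (w + 1) * C / ((w + 2) / 2) * (w + 2))"
      using pos C by (simp only: IH) (simp add: divide_simps)
    finally show ?thesis using 0 by (simp only: C' w' H.simps t_def power_Suc mult_1_right)
  next
    case (Suc p')
    have "coef (2 * Suc p' + 1) (2 * Suc k + 1) =
        (w * coef (2 * Suc p' + 1) (2 * k + 1) + coef (2 * p' + 1) (2 * k + 1) / w) / (w + 1)"
      by (simp add: w_def)
    also have "\<dots> = 4 * t * (H (Suc (Suc p')) (Suc k) + H (Suc p') (Suc k) / w\<^sup>2)
        / (2 * (w + 1) * C / ((w + 2) / 2) * (w + 2))"
      using pos C by (simp only: IH) (simp del: H.simps add: divide_simps power2_eq_square, algebra)
    also have "H (Suc (Suc p')) (Suc k) + H (Suc p') (Suc k) / w\<^sup>2 = H (Suc (Suc p')) (Suc (Suc k))"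
      by (simp add: w_def algebra_simps power2_eq_square)
    finally show ?thesis using Suc by (simp only: C' w' t_def power_Suc)
  qed
qed

section \<open>Powers of the arcsine\<close>

lemma DERIV_arcsin_power:
  fixes x :: real
  assumes "\<bar>x\<bar> < 1"
  shows "((\<lambda>z. arcsin z ^ Suc q / fact (Suc q)) has_field_derivative
           arcsin x ^ q / fact q / sqrt (1 - x\<^sup>2)) (at x)"
proof -
  have "arcsin x ^ q / fact q / sqrt (1 - x\<^sup>2) =
      real (Suc q) * (inverse (sqrt (1 - x\<^sup>2)) * arcsin x ^ q) / fact (Suc q)"
    by (simp add: divide_inverse mult_ac del: of_nat_Suc)
  then show ?thesis
    using assms DERIV_cdivide[OF DERIV_power[OF DERIV_arcsin[of x], of "Suc q"], of "fact (Suc q)"]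
    by (simp del: of_nat_Suc power_Suc fact_Suc)
qed

lemma sqrt_1_minus_square_pos:
  fixes x :: real
  assumes "\<bar>x\<bar> < 1"
  shows "0 < sqrt (1 - x\<^sup>2)"
  using assms by (simp add: abs_square_less_1)

text \<open>The left side of the equation is \<open>y' - x * (x * y' + y)\<close>, and
  \<open>x * y' + y\<close> has coefficients \<open>(m + 1) * coef q m\<close>.\<close>

lemma coef_differential_equation:
  assumes y: "\<And>x. \<bar>x\<bar> < 1 \<Longrightarrow> (\<lambda>i. coef q i * x ^ i) sums y x"
    and y': "\<And>x. \<bar>x\<bar> < 1 \<Longrightarrow> (\<lambda>i. diffs (coef q) i * x ^ i) sums y' x"
    and x: "\<bar>x\<bar> < 1"
  shows "(\<lambda>m. (real (m + 1) * coef q (m + 1) - real m * coef q (m - 1)) * x ^ m) sums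
           ((1 - x\<^sup>2) * y' x - x * y x)"
proof -
  have s1: "(\<lambda>m. real (m + 1) * coef q (m + 1) * x ^ m) sums y' x"
    using y'[OF x] by (simp add: diffs_def)
  have "(\<lambda>m. real (Suc m) * coef q (Suc m) * x ^ Suc m) sums (x * y' x)"
    using sums_mult[OF s1, of x] by (simp add: mult_ac)
  then have "(\<lambda>m. real m * coef q m * x ^ m) sums (x * y' x)"
    by (subst (asm) sums_Suc_iff) simp
  from sums_mult[OF sums_add[OF this y[OF x]], of x]
  have "(\<lambda>m. real (Suc m) * coef q m * x ^ Suc m) sums (x * (x * y' x + y x))"
    by (simp add: algebra_simps)
  \<comment> \<open>At \<open>m = 0\<close> truncated subtraction reads \<open>coef q 0\<close>, but
    the factor \<open>real m\<close> makes the added term 0.\<close>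
  then have "(\<lambda>m. real m * coef q (m - 1) * x ^ m) sums (x * (x * y' x + y x))"
    by (subst sums_zero_iff_shift[symmetric, of 1]) auto
  from sums_diff[OF s1 this] show ?thesis
    by (simp add: algebra_simps power2_eq_square)
qed

text \<open>The series is shown to solve the differential equation, whose solution is fixed by its
  value at 0. Strong induction supplies the expansion for \<open>q - 2\<close>, which the right-hand
  side needs.\<close>

lemma coef_sums:
  fixes x :: real
  assumes "\<bar>x\<bar> < 1"
  shows "(\<lambda>i. coef q i * x ^ i) sums (arcsin x ^ q / fact q / sqrt (1 - x\<^sup>2))"
  using assms
proof (induction q arbitrary: x rule: less_induct)
  case (less q)
  define y where "y = (\<lambda>z. \<Sum>i. coef q i * z ^ i)"
  define y' where "y' = (\<lambda>z. \<Sum>i. diffs (coef q) i * z ^ i)"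
  have summ: "summable (\<lambda>i. coef q i * z ^ i)" if "\<bar>z\<bar> < 1" for z
  proof (rule summable_comparison_test'[where N = 0 and g = "\<lambda>i. \<bar>z\<bar> ^ i"])
    show "summable (\<lambda>i. \<bar>z\<bar> ^ i)" using that by (simp add: summable_geometric)
    show "norm (coef q i * z ^ i) \<le> \<bar>z\<bar> ^ i" for i
      using coef_nonneg[of q i] coef_le_1[of q i]
      by (auto simp: abs_mult power_abs intro!: mult_left_le_one_le)
  qed
  have der: "(y has_field_derivative y' z) (at z)" if "\<bar>z\<bar> < 1" for z
    unfolding y_def y'_def by (rule termdiffs_strong'[where K = 1]) (use summ that in auto)
  have summ': "summable (\<lambda>i. diffs (coef q) i * z ^ i)" if "\<bar>z\<bar> < 1" for z
    by (rule termdiff_converges[where K = 1]) (use summ that in auto)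
  have ode: "(\<lambda>m. (real (m + 1) * coef q (m + 1) - real m * coef q (m - 1)) * z ^ m) sums
           ((1 - z\<^sup>2) * y' z - z * y z)" if "\<bar>z\<bar> < 1" for z
    by (rule coef_differential_equation)
       (use summ summ' that in \<open>auto simp: y_def y'_def summable_sums\<close>)
  have rhs: "(1 - z\<^sup>2) * y' z - z * y z =
      (if q = 0 then 0 else arcsin z ^ (q - 1) / fact (q - 1))" if z: "\<bar>z\<bar> < 1" for z
  proof -
    consider "q = 0" | "q = 1" | q' where "q = Suc (Suc q')"
      by (metis One_nat_def not0_implies_Suc)
    then have "(\<lambda>m. (real (m + 1) * coef q (m + 1) - real m * coef q (m - 1)) * z ^ m) sums
        (if q = 0 then 0 else arcsin z ^ (q - 1) / fact (q - 1))"
    proof cases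
      case 1
      have "real (m + 1) * coef q (m + 1) - real m * coef q (m - 1) = 0" for m
        using 1 by (cases m) auto
      then show ?thesis using 1 by simp
    next
      case 2
      have "real (m + 1) * coef q (m + 1) - real m * coef q (m - 1) = (if m = 0 then 1 else 0)" for m
        using 2 by (cases m) auto
      then have "(\<lambda>m. (real (m + 1) * coef q (m + 1) - real m * coef q (m - 1)) * z ^ m) =
          (\<lambda>m. if m = 0 then 1 else 0)" by auto
      then show ?thesis using 2 sums_single[of 0 "\<lambda>_. 1::real"] by simp
    next
      case 3
      have "(\<lambda>i. coef q' i / real (Suc i) * z ^ Suc i) sums (arcsin z ^ Suc q' / fact (Suc q'))"
        by (rule power_series_sums_antiderivative[OF less.IH DERIV_arcsin_power])
           (use 3 z in auto)
      then have "(\<lambda>m. (real (Suc m + 1) * coef q (Suc m + 1) - real (Suc m) * coef q (Suc m - 1)) * z ^ Suc m)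
          sums (arcsin z ^ Suc q' / fact (Suc q'))"
        using 3 by (simp del: power_Suc)
      \<comment> \<open>The restored term at \<open>m = 0\<close> is \<open>coef q 1\<close>, which
        is 0 since \<open>q\<close> is at least 2.\<close>
      then show ?thesis
        by (subst (asm) sums_Suc_iff) (use 3 in \<open>simp del: power_Suc\<close>)
    qed
    with ode[OF z] show ?thesis by (rule sums_unique2)
  qed
  \<comment> \<open>\<open>sqrt (1 - z\<^sup>2)\<close> is an integrating factor: by the
    differential equation, its product with \<open>y\<close> has the same derivative as
    \<open>arcsin z ^ q / fact q\<close>.\<close>
  define u where "u = (\<lambda>z. y z * sqrt (1 - z\<^sup>2) - arcsin z ^ q / fact q)"
  have u': "(u has_field_derivative 0) (at z)" if z: "\<bar>z\<bar> < 1" for z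
  proof -
    define s where "s = sqrt (1 - z\<^sup>2)"
    have s: "s > 0" "s * s = 1 - z\<^sup>2"
      using sqrt_1_minus_square_pos[OF z] by (auto simp: s_def)
    have A: "((\<lambda>z. arcsin z ^ q / fact q) has_field_derivative
        (if q = 0 then 0 else arcsin z ^ (q - 1) / fact (q - 1)) / s) (at z)"
      using DERIV_arcsin_power[OF z, of "q - 1"] by (cases q) (auto simp: s_def)
    have "((\<lambda>z. sqrt (1 - z\<^sup>2)) has_field_derivative - z / s) (at z)"
      using s by (auto intro!: derivative_eq_intros simp: s_def field_simps)
    from DERIV_diff[OF DERIV_mult[OF der[OF z] this] A]
    have "(u has_field_derivative
        y' z * s + - z / s * y z - (if q = 0 then 0 else arcsin z ^ (q - 1) / fact (q - 1)) / s) (at z)"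
      by (simp add: u_def s_def)
    moreover have "y' z * s = (1 - z\<^sup>2) * y' z / s"
      using s by (simp add: field_simps flip: s(2))
    ultimately show ?thesis
      unfolding rhs[OF z, symmetric] by (simp add: diff_divide_distrib)
  qed
  have "u x = u 0"
    using u' less.prems
    by (intro DERIV_isconst3[of "-1" 1 x 0]) auto
  moreover have "u 0 = 0"
    by (cases q) (auto simp: u_def y_def powser_zero)
  ultimately have "y x = arcsin x ^ q / fact q / sqrt (1 - x\<^sup>2)"
    using sqrt_1_minus_square_pos[OF less.prems] by (simp add: u_def field_simps)
  then show ?case using summ[OF less.prems] by (simp add: y_def sums_iff)
qed

section \<open>Integration by parts up to the endpoints\<close>

lemma ex_antiderivative_I:
  obtains J where "\<And>x. \<bar>x\<bar> \<le> 1 \<Longrightarrow> I n q x = J x"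
    "\<And>x. \<bar>x\<bar> \<le> 1 \<Longrightarrow> (J has_field_derivative x ^ n * arcsin x ^ q) (at x within {-1..1})"
proof -
  have cont: "continuous_on {-1..1} (\<lambda>t::real. t ^ n * arcsin t ^ q)"
    by (auto intro!: continuous_intros)
  then obtain J where J: "\<And>x. x \<in> {-1..1} \<Longrightarrow>
      (J has_vector_derivative x ^ n * arcsin x ^ q) (at x within {-1..1})"
    using antiderivative_continuous by blast
  \<comment> \<open>Subtracting \<open>J 0\<close> matches the lower limit of the integral.
    Derivatives are taken within the closed interval, hence one-sided at the endpoints, which later
    yields continuity there.\<close>
  show ?thesis
  proof (rule that[of "\<lambda>x. J x - J 0"])
    fix x :: real assume x: "\<bar>x\<bar> \<le> 1"
    then have sub: "{min 0 x..max 0 x} \<subseteq> {-1..1}" by auto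
    have "(LBINT t=ereal 0..ereal x. t ^ n * arcsin t ^ q) = J x - J 0"
    proof (rule interval_integral_FTC_finite)
      show "continuous_on {min 0 x..max 0 x} (\<lambda>t. t ^ n * arcsin t ^ q)"
        using cont sub by (rule continuous_on_subset)
      show "(J has_vector_derivative z ^ n * arcsin z ^ q) (at z within {min 0 x..max 0 x})"
        if "min 0 x \<le> z" "z \<le> max 0 x" for z
        by (rule has_vector_derivative_within_subset[OF J sub]) (use sub that in auto)
    qed
    then show "I n q x = J x - J 0" by (simp add: I_def zero_ereal_def)
    show "((\<lambda>x. J x - J 0) has_field_derivative x ^ n * arcsin x ^ q) (at x within {-1..1})"
      using J[of x] x
      by (auto simp: has_real_derivative_iff_has_vector_derivative abs_le_iff
               intro!: derivative_eq_intros)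
  qed
qed

text \<open>Differentiating the right-hand side, the two terms with \<open>(n + 1) * x ^ n\<close>
  cancel and \<open>x ^ (n + 1) * y\<^sub>q\<close> remains. Its series is integrated termwise and
  then extended to the closed interval, for both parities of \<open>q\<close> at once.\<close>

lemma coef_sums_integral:
  fixes x :: real
  assumes x: "\<bar>x\<bar> \<le> 1"
  shows "(\<lambda>j. coef q j * (x ^ (j + n + 2) / real (j + n + 2))) sums
           (arcsin x ^ Suc q / fact (Suc q) * x ^ (n + 1)
              - real (n + 1) / fact (Suc q) * I n (Suc q) x)"
proof -
  obtain J where J: "\<And>x. \<bar>x\<bar> \<le> 1 \<Longrightarrow> I n (Suc q) x = J x"
    and J': "\<And>x. \<bar>x\<bar> \<le> 1 \<Longrightarrow>
      (J has_field_derivative x ^ n * arcsin x ^ Suc q) (at x within {-1..1})"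
    using ex_antiderivative_I by blast
  define F where "F = (\<lambda>x. arcsin x ^ Suc q / fact (Suc q) * x ^ (n + 1) - real (n + 1) / fact (Suc q) * J x)"
  define a where "a = (\<lambda>i. if i < n + 1 then 0 else coef q (i - (n + 1)))"
  have a: "(\<lambda>i. a i * z ^ i) sums (z ^ (n + 1) * (arcsin z ^ q / fact q / sqrt (1 - z\<^sup>2)))"
    if "\<bar>z\<bar> < 1" for z
  proof (subst sums_zero_iff_shift[symmetric, of "n + 1"])
    show "(\<lambda>i. a (i + (n + 1)) * z ^ (i + (n + 1))) sums
        (z ^ (n + 1) * (arcsin z ^ q / fact q / sqrt (1 - z\<^sup>2)))"
      using sums_mult[OF coef_sums[OF that], of "z ^ (n + 1)" q]
      by (simp add: a_def power_add mult_ac)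
  qed (simp add: a_def)
  have F': "(F has_field_derivative z ^ (n + 1) * (arcsin z ^ q / fact q / sqrt (1 - z\<^sup>2))) (at z)"
    if z: "\<bar>z\<bar> < 1" for z
  proof -
    have "at z within {-1..1} = at z"
      by (rule at_within_interior) (use z in auto)
    then have "(J has_field_derivative z ^ n * arcsin z ^ Suc q) (at z)"
      using J'[of z] z by simp
    from DERIV_diff[OF DERIV_mult[OF DERIV_arcsin_power[OF z, of q] DERIV_pow[of "n + 1"]] 
        DERIV_cmult[OF this, of "real (n + 1) / fact (Suc q)"]]
    show ?thesis by (simp add: F_def mult_ac del: fact_Suc power_Suc)
  qed
  have J0: "J 0 = 0" using J[of 0] by (simp add: I_def zero_ereal_def[symmetric])
  have sums: "(\<lambda>i. a i / real (Suc i) * z ^ Suc i) sums F z" if "\<bar>z\<bar> < 1" for z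
    by (rule power_series_sums_antiderivative[OF a F']) (use that J0 in \<open>auto simp: F_def\<close>)
  \<comment> \<open>Reindexing by the exponent gives the plain power series form needed for the
    extension; the first \<open>n + 2\<close> entries are 0 and are dropped at the end.\<close>
  define b where "b = (\<lambda>i. if i = 0 then 0 else a (i - 1) / real i)"
  have b: "(\<lambda>i. b i * x ^ i) sums F x"
  proof (rule power_series_sums_closed_interval)
    show "0 \<le> b i" for i by (auto simp: b_def a_def coef_nonneg)
    show "(\<lambda>i. b i * z ^ i) sums F z" if "\<bar>z\<bar> < 1" for z
      by (subst sums_zero_iff_shift[symmetric, of 1])
         (use sums[OF that] in \<open>auto simp: b_def\<close>)
    have "continuous_on {-1..1} J"
      by (rule DERIV_continuous_on[OF J']) auto
    then show "continuous_on {-1..1} F"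
      unfolding F_def by (auto intro!: continuous_intros)
  qed (fact x)
  have "(\<lambda>j. b (j + (n + 2)) * x ^ (j + (n + 2))) sums F x"
    by (subst sums_zero_iff_shift) (use b in \<open>auto simp: b_def a_def\<close>)
  moreover have "b (j + (n + 2)) * x ^ (j + (n + 2)) = coef q j * (x ^ (j + n + 2) / real (j + n + 2))" for j
    by (simp add: b_def a_def add_ac)
  ultimately show ?thesis using J[OF x] by (simp only: F_def)
qed

section \<open>The two identities by parity\<close>

theorem lemma3p1:
  fixes x :: real
  assumes "\<bar>x\<bar> \<le> 1"
  shows "(\<forall>(n::nat) (p::nat).
            (\<lambda>k::nat. real ((2 * k) choose k) * G p k / 4 ^ k
                  * (x ^ (2 * k + n + 2) / real (2 * k + n + 2)))
            sums (arcsin x ^ (2 * p + 1) / fact (2 * p + 1) * x ^ (n + 1)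
                  - real (n + 1) / fact (2 * p + 1) * I n (2 * p + 1) x))
       \<and> (\<forall>(n::nat) (p::nat). p \<ge> 1 \<longrightarrow>
            (\<lambda>j::nat. let k = j + 1 in
                  4 ^ k * H p k / (real ((2 * k) choose k) * real (2 * k))
                  * (x ^ (2 * k + n + 1) / real (2 * k + n + 1)))
            sums (arcsin x ^ (2 * p) / fact (2 * p) * x ^ (n + 1)
                  - real (n + 1) / fact (2 * p) * I n (2 * p) x))"
proof (intro conjI allI impI)
  fix n p :: nat
  let ?s = "\<lambda>q j. coef q j * (x ^ (j + n + 2) / real (j + n + 2))"
  have "(\<lambda>k. ?s (2 * p) (2 * k)) sums (arcsin x ^ Suc (2 * p) / fact (Suc (2 * p)) * x ^ (n + 1)
          - real (n + 1) / fact (Suc (2 * p)) * I n (Suc (2 * p)) x)"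
  \<comment> \<open>Terms of odd index vanish by parity, so the series may be summed along even
    indices only.\<close>
  proof (subst sums_mono_reindex[of "\<lambda>k. 2 * k"])
    show "?s (2 * p) j = 0" if "j \<notin> range (\<lambda>k. 2 * k)" for j
      using that coef_eq_0[of "2 * p" j] by (auto elim: evenE)
  qed (use coef_sums_integral[OF assms] in \<open>simp_all add: strict_mono_def del: power_Suc fact_Suc\<close>)
  then show "(\<lambda>k::nat. real ((2 * k) choose k) * G p k / 4 ^ k
                  * (x ^ (2 * k + n + 2) / real (2 * k + n + 2)))
            sums (arcsin x ^ (2 * p + 1) / fact (2 * p + 1) * x ^ (n + 1)
                  - real (n + 1) / fact (2 * p + 1) * I n (2 * p + 1) x)"
    by (simp only: coef_even Suc_eq_plus1)
next
  fix n p :: nat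
  assume "p \<ge> 1"
  then obtain p' where p: "p = Suc p'" by (cases p) auto
  let ?s = "\<lambda>q j. coef q j * (x ^ (j + n + 2) / real (j + n + 2))"
  have "(\<lambda>k. ?s (2 * p' + 1) (2 * k + 1)) sums
      (arcsin x ^ Suc (2 * p' + 1) / fact (Suc (2 * p' + 1)) * x ^ (n + 1)
          - real (n + 1) / fact (Suc (2 * p' + 1)) * I n (Suc (2 * p' + 1)) x)"
  proof (subst sums_mono_reindex[of "\<lambda>k. 2 * k + 1"])
    show "?s (2 * p' + 1) j = 0" if "j \<notin> range (\<lambda>k. 2 * k + 1)" for j
    proof -
      have "even j" using that by (metis oddE rangeI)
      then show ?thesis using coef_eq_0[of "2 * p' + 1" j] by simp
    qed
  qed (use coef_sums_integral[OF assms] in \<open>simp_all add: strict_mono_def del: power_Suc fact_Suc\<close>)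
  \<comment> \<open>The shift from \<open>k\<close> to \<open>Suc k\<close> turns the exponent into
    the one of a series starting at 1.\<close>
  moreover have "Suc (2 * p' + 1) = 2 * p" "2 * k + 1 + n + 2 = 2 * Suc k + n + 1" for k
    using p by auto
  ultimately show "(\<lambda>j::nat. let k = j + 1 in
                  4 ^ k * H p k / (real ((2 * k) choose k) * real (2 * k))
                  * (x ^ (2 * k + n + 1) / real (2 * k + n + 1)))
            sums (arcsin x ^ (2 * p) / fact (2 * p) * x ^ (n + 1)
                  - real (n + 1) / fact (2 * p) * I n (2 * p) x)"
    by (simp only: coef_odd p Let_def Suc_eq_plus1)
qed

end
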